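(* Let $d\ge 1$, let $\Sigma$ be a finite alphabet, and let $X\subseteq\Sigma^{\mathbb Z^d}$ be a nonempty symmetric nearest-neighbor subshift (of finite type) with topological entropy $h$. For $n\ge 1$ let $C_n$ be the number of locally admissible patterns on the cube $[1,n]^d$. Then for every $n\ge 1$, \[ \frac{1}{n^d}\bigl(\log C_{n+1}-q_d(n)\log|\Sigma|\bigr)\le h\le \frac{1}{n^d}\log C_n, \] where \[ q_d(n)=(2^d-1)\sum_{k=0}^{d-1}\frac{\binom{d}{k}}{2^d-2^k}\,n^k . \]
   Context: Here $[1,n]=\{1,\dots,n\}$ and $e_1,\dots,e_d$ are the standard unit vectors of $\mathbb Z^d$. A nearest-neighbor subshift is given by sets $F_1,\dots,F_d\subset\Sigma^2$ of forbidden adjacent pairs, one for each coordinate direction (the $F_i$ may differ from each other): $X$ is the set of all $x\in\Sigma^{\mathbb Z^d}$ such that $(x(v),x(v+e_i))\notin F_i$ for all $v\in\mathbb Z^d$ and all $i=1,\dots,d$. It is symmetric if $(a,b)\in F_i\iff(b,a)\in F_i$ for all $a,b\in\Sigma$ and all $i=1,\dots,d$. A pattern $P\in\Sigma^{[1,n]^d}$ is locally admissible if no two adjacent points of $[1,n]^d$ form a forbidden pair, i.e. $(P(v),P(v+e_i))\notin F_i$ whenever $v,v+e_i\in[1,n]^d$. It is globally admissible if it is the restriction to $[1,n]^d$ of some $x\in X$. The topological entropy is $h=\lim_{n\to\infty}\frac{1}{n^d}\log G_n$, where $G_n$ is the number of globally admissible patterns on $[1,n]^d$. *)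

theory Defs
  imports "HOL-Analysis.Analysis"
begin

text \<open>
  The lattice is \<open>int ^ 'd\<close>, of dimension \<open>CARD('d)\<close>; the alphabet is the finite type \<open>'a\<close>.
  \<open>F i\<close> is the set of forbidden pairs in the direction of the unit vector \<open>axis i 1\<close>.
\<close>

type_synonym ('a, 'd) config = "int ^ 'd \<Rightarrow> 'a"

definition nn_subshift :: "('d::finite \<Rightarrow> ('a \<times> 'a) set) \<Rightarrow> ('a, 'd) config set" where
  "nn_subshift F = {x. \<forall>v i. (x v, x (v + axis i 1)) \<notin> F i}"

definition symmetric_constraints :: "('d::finite \<Rightarrow> ('a \<times> 'a) set) \<Rightarrow> bool" where
  "symmetric_constraints F \<longleftrightarrow> (\<forall>i a b. (a, b) \<in> F i \<longleftrightarrow> (b, a) \<in> F i)"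

definition cube :: "nat \<Rightarrow> (int ^ 'd::finite) set" where
  "cube n = {v. \<forall>i. v $ i \<in> {1..int n}}"

text \<open>
  A pattern on the cube is a function that is \<open>undefined\<close> outside it, so that
  distinct functions are distinct patterns and \<open>card\<close> counts correctly.
\<close>

definition locally_admissible ::
    "('d::finite \<Rightarrow> ('a \<times> 'a) set) \<Rightarrow> nat \<Rightarrow> ('a, 'd) config set" where
  "locally_admissible F n =
     {P \<in> cube n \<rightarrow>\<^sub>E UNIV.
        \<forall>v i. v \<in> cube n \<longrightarrow> v + axis i 1 \<in> cube n \<longrightarrow> (P v, P (v + axis i 1)) \<notin> F i}"

definition globally_admissible :: "('a, 'd::finite) config set \<Rightarrow> nat \<Rightarrow> ('a, 'd) config set" where
  "globally_admissible X n = (\<lambda>x. restrict x (cube n)) ` X"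

definition topological_entropy :: "('a, 'd::finite) config set \<Rightarrow> real" where
  "topological_entropy X =
     lim (\<lambda>n. 1 / real n ^ CARD('d) * ln (real (card (globally_admissible X n))))"

definition q :: "nat \<Rightarrow> nat \<Rightarrow> real" where
  "q d n = (2 ^ d - 1) * (\<Sum>k<d. real (d choose k) / (2 ^ d - 2 ^ k) * real n ^ k)"

end

theory Submission
  imports Defs
begin

text \<open>
  Reflecting a pattern on a box in one of its faces doubles the box. By symmetry of the constraints,
  any two admissible patterns that agree on the face glue to an admissible pattern on the doubled
  box, so by Cauchy-Schwarz the proportion \<open>p\<close> of admissible patterns among all patterns
  satisfies \<open>p(doubled box) \<ge> p(box)\<^sup>2\<close>. Doubling \<open>j\<close> times in all \<open>d\<close> directions takes the cube
  of side \<open>n + 1\<close> to the cube of side \<open>2 ^ j * n + 1\<close> and multiplies \<open>- ln p\<close> by at most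
  \<open>2 ^ (d * j)\<close>. Iterated reflection also folds \<open>\<int> ^ d\<close> onto a cube of side at least 2, so
  locally admissible patterns on it are globally admissible. In the limit the entropy is at least
  \<open>(ln C\<^sub>n\<^sub>+\<^sub>1 - ((n + 1) ^ d - n ^ d) * ln |\<Sigma>|) / n ^ d\<close>, and \<open>(n + 1) ^ d - n ^ d \<le> q d n\<close>.
  The upper bound is subadditivity, which also shows that the limit defining the entropy exists.
\<close>

section \<open>Admissible patterns on arbitrary sets of sites\<close>

text \<open>The domain is an arbitrary set of sites because doubling a cube one direction at a time
  passes through boxes of unequal sides.\<close>

definition admissible ::
    "('d::finite \<Rightarrow> ('a \<times> 'a) set) \<Rightarrow> (int ^ 'd) set \<Rightarrow> ('a, 'd) config set" where
  "admissible F S =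
     {P \<in> S \<rightarrow>\<^sub>E UNIV. \<forall>v i. v \<in> S \<longrightarrow> v + axis i 1 \<in> S \<longrightarrow> (P v, P (v + axis i 1)) \<notin> F i}"

lemma locally_admissible_eq: "locally_admissible F n = admissible F (cube n)"
  by (simp add: locally_admissible_def admissible_def)

lemma admissible_subset: "admissible F S \<subseteq> S \<rightarrow>\<^sub>E UNIV"
  by (auto simp: admissible_def)

lemma finite_admissible:
  fixes F :: "'d::finite \<Rightarrow> ('a::finite \<times> 'a) set"
  assumes "finite S"
  shows "finite (admissible F S)"
  by (rule finite_subset[OF admissible_subset]) (simp add: finite_PiE assms)

lemma card_admissible_le:
  fixes F :: "'d::finite \<Rightarrow> ('a::finite \<times> 'a) set"
  assumes "finite S"
  shows "card (admissible F S) \<le> CARD('a) ^ card S"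
proof -
  have "card (admissible F S) \<le> card (S \<rightarrow>\<^sub>E (UNIV :: 'a set))"
    using admissible_subset by (intro card_mono finite_PiE assms) auto
  then show ?thesis
    using assms by (simp add: card_PiE)
qed

lemma restrict_in_admissible:
  assumes "x \<in> nn_subshift F"
  shows "restrict x S \<in> admissible F S"
  using assms by (auto simp: admissible_def nn_subshift_def)

lemma admissible_nonempty:
  assumes "nn_subshift F \<noteq> {}"
  shows "admissible F S \<noteq> {}"
  using assms restrict_in_admissible by blast

section \<open>Doubling by reflection\<close>

text \<open>The mirror is the lattice hyperplane \<open>v $ i = c\<close>, and its sites stay fixed.
  Hence side \<open>m + 1\<close> doubles to \<open>2 * m + 1\<close>, the mirror layer being
  shared.\<close>

definition reflect :: "'d::finite \<Rightarrow> int \<Rightarrow> int ^ 'd \<Rightarrow> int ^ 'd" where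
  "reflect i c v = (\<chi> j. if j = i then 2 * c - v $ j else v $ j)"

lemma reflect_nth: "reflect i c v $ j = (if j = i then 2 * c - v $ j else v $ j)"
  by (simp add: reflect_def)

lemma reflect_reflect [simp]: "reflect i c (reflect i c v) = v"
  by (simp add: vec_eq_iff reflect_nth)

lemma inj_reflect: "inj (reflect i c)"
  by (metis injI reflect_reflect)

lemma reflect_image_iff: "v \<in> reflect i c ` S \<longleftrightarrow> reflect i c v \<in> S"
  by (metis image_iff reflect_reflect)

lemma reflect_fixed: "v $ i = c \<Longrightarrow> reflect i c v = v"
  by (simp add: vec_eq_iff reflect_nth)

text \<open>Steps parallel to the mirror are preserved and steps across it are reversed; the
  reversal is what calls for symmetric constraints.\<close>

lemma reflect_step:
  "j \<noteq> i \<Longrightarrow> reflect i c (v + axis j 1) = reflect i c v + axis j 1"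
  "reflect i c (v + axis i 1) + axis i 1 = reflect i c v"
  by (auto simp: vec_eq_iff reflect_nth axis_def)

text \<open>Since \<open>S\<close> lies on one side of the mirror, it meets its reflection exactly
  in its sites on the mirror.\<close>

lemma card_reflection_double:
  fixes S :: "(int ^ 'd::finite) set"
  assumes S: "finite S" "\<And>v. v \<in> S \<Longrightarrow> v $ i \<le> c"
  shows "card (S \<union> reflect i c ` S) + card {v \<in> S. v $ i = c} = 2 * card S"
proof -
  have "v $ i = c" if "v \<in> S" "reflect i c v \<in> S" for v
    using that S(2)[of v] S(2)[of "reflect i c v"] by (simp add: reflect_nth)
  moreover have "reflect i c v \<in> S" if "v \<in> S" "v $ i = c" for v
    using that(1) unfolding reflect_fixed[of v i c, OF that(2)] .
  ultimately have "S \<inter> reflect i c ` S = {v \<in> S. v $ i = c}"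
    unfolding set_eq_iff Int_iff mem_Collect_eq reflect_image_iff by blast
  moreover have "card (reflect i c ` S) = card S"
    by (meson card_image inj_on_subset inj_reflect subset_UNIV)
  ultimately show ?thesis
    using card_Un_Int[of S "reflect i c ` S"] S(1) by simp
qed

text \<open>Every adjacent pair of the doubled set lies wholly in \<open>S\<close>, where
  \<open>P\<close> decides, or wholly in the reflected copy, where \<open>Q\<close> decides. In the
  copy a pair in direction \<open>i\<close> is read backwards, and symmetry makes it
  allowed.\<close>

lemma glue_reflected:
  fixes F :: "'d::finite \<Rightarrow> ('a \<times> 'a) set"
  assumes sym: "symmetric_constraints F"
    and S: "\<And>v. v \<in> S \<Longrightarrow> v $ i \<le> c"
    and P: "P \<in> admissible F S" and Q: "Q \<in> admissible F S"
    and agree: "\<And>v. v \<in> S \<Longrightarrow> v $ i = c \<Longrightarrow> P v = Q v"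
  shows "restrict (\<lambda>v. if v \<in> S then P v else Q (reflect i c v)) (S \<union> reflect i c ` S)
           \<in> admissible F (S \<union> reflect i c ` S)"
    (is "restrict ?R ?S' \<in> _")
proof -
  have Q_ok: "(Q w, Q (w + axis j 1)) \<notin> F j" if "w \<in> S" "w + axis j 1 \<in> S" for w j
    using Q that by (simp add: admissible_def)
  \<comment> \<open>The set and its copy overlap only on the mirror, where \<open>P\<close> and
    \<open>Q\<close> agree, so \<open>Q\<close> describes the glued pattern on the whole
    copy.\<close>
  have R_reflected: "?R v = Q (reflect i c v)" if "reflect i c v \<in> S" for v
  proof (cases "v \<in> S")
    case True
    with that have "v $ i = c"
      using S[of v] S[of "reflect i c v"] by (simp add: reflect_nth)
    with True show ?thesis
      using agree by (simp add: reflect_fixed)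
  qed simp
  have step: "(?R v, ?R (v + axis j 1)) \<notin> F j" if v: "v \<in> ?S'" "v + axis j 1 \<in> ?S'" for v j
  proof -
    \<comment> \<open>A unit step cannot jump over the mirror: a step from \<open>S\<close> to a
      site outside it ends strictly beyond \<open>c\<close>, so it starts on the mirror, at a site
      which is its own reflection.\<close>
    have in_S: "reflect i c v \<in> S \<and> reflect i c (v + axis j 1) \<in> S"
      if "\<not> (v \<in> S \<and> v + axis j 1 \<in> S)"
    proof (cases "v \<in> S")
      case True
      then have w: "reflect i c (v + axis j 1) \<in> S" "v + axis j 1 \<notin> S"
        using that v by (auto simp: reflect_image_iff)
      then have "c \<le> (v + axis j 1) $ i"
        using S[of "reflect i c (v + axis j 1)"] by (simp add: reflect_nth)
      moreover have "(v + axis j 1) $ i \<noteq> c"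
        using w reflect_fixed[of "v + axis j 1" i c] by auto
      ultimately have "v $ i = c"
        using S[OF True] by (auto simp: axis_def split: if_splits)
      with True w show ?thesis
        by (simp add: reflect_fixed)
    next
      case False
      then have w: "reflect i c v \<in> S"
        using v by (auto simp: reflect_image_iff)
      then have "c \<le> v $ i"
        using S[OF w] by (simp add: reflect_nth)
      moreover have "v $ i \<noteq> c"
        using w False reflect_fixed[of v i c] by auto
      \<comment> \<open>All steps go in positive directions, so none leads from beyond the mirror
        back to it.\<close>
      ultimately have "\<not> (v + axis j 1) $ i \<le> c"
        by (auto simp: axis_def)
      then have "v + axis j 1 \<notin> S"
        using S by blast
      with v w show ?thesis
        by (auto simp: reflect_image_iff)
    qed
    show ?thesis
    proof (cases "v \<in> S \<and> v + axis j 1 \<in> S")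
      case True
      then show ?thesis
        using P by (simp add: admissible_def)
    next
      case False
      note w = in_S[OF False]
      have "(Q (reflect i c v), Q (reflect i c (v + axis j 1))) \<notin> F j"
      proof (cases "j = i")
        case True
        have "(Q (reflect i c (v + axis i 1)), Q (reflect i c v)) \<notin> F i"
          using Q_ok[of "reflect i c (v + axis i 1)" i] w unfolding True reflect_step(2) by blast
        then show ?thesis
          using sym unfolding True symmetric_constraints_def by blast
      next
        case False
        then show ?thesis
          using Q_ok[of "reflect i c v" j] w by (simp add: reflect_step(1))
      qed
      then show ?thesis
        unfolding R_reflected[OF conjunct1[OF w]] R_reflected[OF conjunct2[OF w]] .
    qed
  qed
  show ?thesis
    unfolding admissible_def
  proof (intro CollectI conjI allI impI)
    show "restrict ?R ?S' \<in> ?S' \<rightarrow>\<^sub>E UNIV"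
      by simp
    fix v j assume v: "v \<in> ?S'" "v + axis j 1 \<in> ?S'"
    show "(restrict ?R ?S' v, restrict ?R ?S' (v + axis j 1)) \<notin> F j"
      unfolding restrict_apply'[OF v(1)] restrict_apply'[OF v(2)] by (rule step[OF v])
  qed
qed

section \<open>Counting glued pairs by Cauchy-Schwarz\<close>

text \<open>The pairs with equal image are counted by the sum of the squared fibre sizes;
  Cauchy-Schwarz compares this with the squared sum, taking the constant 1 as the other
  factor.\<close>

lemma square_card_le_fibres:
  fixes f :: "'b \<Rightarrow> 'c"
  assumes "finite A" "finite B" "f ` A \<subseteq> B"
  shows "card A ^ 2 \<le> card B * card {(x, y). x \<in> A \<and> y \<in> A \<and> f x = f y}"
proof -
  define N where "N b = card {x \<in> A. f x = b}" for b
  have fib: "A = (\<Union>b\<in>B. {x \<in> A. f x = b})"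
    using assms(3) by auto
  have "card A = (\<Sum>b\<in>B. N b)"
    unfolding N_def
    by (subst fib, subst card_UN_disjoint) (use assms in auto)
  moreover have "{(x, y). x \<in> A \<and> y \<in> A \<and> f x = f y} =
      (\<Union>b\<in>B. {x \<in> A. f x = b} \<times> {x \<in> A. f x = b})"
    using assms(3) by auto
  then have "card {(x, y). x \<in> A \<and> y \<in> A \<and> f x = f y} = (\<Sum>b\<in>B. N b ^ 2)"
    unfolding N_def
    by (simp, subst card_UN_disjoint)
       (use assms in \<open>auto simp: card_cartesian_product power2_eq_square\<close>)
  moreover have "(\<Sum>b\<in>B. 1 * real (N b))\<^sup>2 \<le> (\<Sum>b\<in>B. 1\<^sup>2) * (\<Sum>b\<in>B. (real (N b))\<^sup>2)"
    by (rule Cauchy_Schwarz_ineq_sum)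
  then have "real ((\<Sum>b\<in>B. N b)\<^sup>2) \<le> real (card B * (\<Sum>b\<in>B. N b ^ 2))"
    by simp
  ultimately show ?thesis
    using of_nat_le_iff by metis
qed

text \<open>Apply the fibre bound to restriction to the mirror face \<open>T\<close>, which takes at
  most \<open>CARD('a) ^ card T\<close> values. Pairs in the same fibre can be glued, and distinct
  pairs give distinct patterns.\<close>

lemma card_admissible_double:
  fixes F :: "'d::finite \<Rightarrow> ('a::finite \<times> 'a) set"
  assumes sym: "symmetric_constraints F"
    and S: "finite S" "\<And>v. v \<in> S \<Longrightarrow> v $ i \<le> c"
  shows "card (admissible F S) ^ 2
           \<le> CARD('a) ^ card {v \<in> S. v $ i = c} * card (admissible F (S \<union> reflect i c ` S))"
proof -
  define T where "T = {v \<in> S. v $ i = c}"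
  define S' where "S' = S \<union> reflect i c ` S"
  define M where "M = {(P, Q). P \<in> admissible F S \<and> Q \<in> admissible F S
    \<and> restrict P T = restrict Q T}"
  define g where "g = (\<lambda>(P :: int ^ 'd \<Rightarrow> 'a, Q :: int ^ 'd \<Rightarrow> 'a).
    restrict (\<lambda>v. if v \<in> S then P v else Q (reflect i c v)) S')"
  have fin: "finite T" "finite S'"
    using S(1) by (auto simp: T_def S'_def)
  have agree: "P v = Q v" if "(P, Q) \<in> M" "v \<in> S" "v $ i = c" for P Q v
  proof -
    have "v \<in> T" "restrict P T = restrict Q T"
      using that by (auto simp: T_def M_def)
    then show ?thesis
      by (metis restrict_apply')
  qed
  have "g ` M \<subseteq> admissible F S'"
  proof safe
    fix P Q assume "(P, Q) \<in> M"
    then show "g (P, Q) \<in> admissible F S'"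
      unfolding g_def S'_def prod.case
      by (intro glue_reflected sym S(2) agree) (auto simp: M_def)
  qed
  moreover have "inj_on g M"
  proof (rule inj_onI, clarify)
    fix P Q P' Q' assume M: "(P, Q) \<in> M" "(P', Q') \<in> M" and eq: "g (P, Q) = g (P', Q')"
    have ext: "P \<in> S \<rightarrow>\<^sub>E UNIV" "Q \<in> S \<rightarrow>\<^sub>E UNIV" "P' \<in> S \<rightarrow>\<^sub>E UNIV" "Q' \<in> S \<rightarrow>\<^sub>E UNIV"
      using M by (auto simp: M_def admissible_def)
    have eqP: "P v = P' v" if "v \<in> S" for v
      using fun_cong[OF eq, of v] that by (simp add: g_def S'_def)
    \<comment> \<open>Off the mirror \<open>Q\<close> is visible in the reflected copy; on it the
      glued pattern shows only \<open>P\<close>, with which \<open>Q\<close> agrees there.\<close>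
    have eqQ: "Q v = Q' v" if v: "v \<in> S" for v
    proof (cases "v $ i = c")
      case True
      then show ?thesis
        using agree[OF M(1) v] agree[OF M(2) v] eqP[OF v] by metis
    next
      case False
      then have "reflect i c v \<notin> S"
        using S(2)[OF v] S(2)[of "reflect i c v"] by (auto simp: reflect_nth)
      then show ?thesis
        using fun_cong[OF eq, of "reflect i c v"] v
        by (simp add: g_def S'_def reflect_image_iff)
    qed
    show "P = P' \<and> Q = Q'"
      using PiE_ext[OF ext(1,3) eqP] PiE_ext[OF ext(2,4) eqQ] by blast
  qed
  ultimately have "card M \<le> card (admissible F S')"
    using card_inj_on_le finite_admissible fin(2) by blast
  moreover have "card (admissible F S) ^ 2 \<le> card (T \<rightarrow>\<^sub>E (UNIV :: 'a set)) * card M"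
    unfolding M_def
    by (rule square_card_le_fibres) (use S(1) fin in \<open>auto intro: finite_admissible finite_PiE\<close>)
  ultimately show ?thesis
    unfolding T_def[symmetric] S'_def[symmetric]
    by (simp add: card_PiE fin) (meson le_trans mult_le_mono2)
qed

section \<open>Logarithmic deficit and its growth under doubling\<close>

text \<open>This is minus the logarithm of the probability that a uniformly random pattern on
  \<open>S\<close> is admissible. In this normalization doubling leaves no boundary term.\<close>

definition deficit :: "('d::finite \<Rightarrow> ('a::finite \<times> 'a) set) \<Rightarrow> (int ^ 'd) set \<Rightarrow> real" where
  "deficit F S = real (card S) * ln (real CARD('a)) - ln (real (card (admissible F S)))"

lemma card_admissible_pos:
  fixes F :: "'d::finite \<Rightarrow> ('a::finite \<times> 'a) set"
  assumes "nn_subshift F \<noteq> {}" "finite S"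
  shows "card (admissible F S) > 0"
  using admissible_nonempty[OF assms(1)] finite_admissible[OF assms(2)] by (simp add: card_gt_0_iff)

lemma deficit_nonneg:
  fixes F :: "'d::finite \<Rightarrow> ('a::finite \<times> 'a) set"
  assumes "nn_subshift F \<noteq> {}" "finite S"
  shows "deficit F S \<ge> 0"
proof -
  have "real (card (admissible F S)) \<le> real CARD('a) ^ card S"
    using card_admissible_le[OF assms(2), of F] by (metis of_nat_le_iff of_nat_power)
  then have "ln (real (card (admissible F S))) \<le> ln (real CARD('a) ^ card S)"
    using card_admissible_pos[OF assms] by (subst ln_le_cancel_iff) auto
  then show ?thesis
    by (simp add: deficit_def ln_realpow)
qed

text \<open>Taking logarithms in \<open>card_admissible_double\<close> costs
  \<open>ln CARD('a)\<close> per mirror site. The doubled set falls short of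
  \<open>2 * card S\<close> by exactly these sites, so the two contributions cancel.\<close>

lemma deficit_double:
  fixes F :: "'d::finite \<Rightarrow> ('a::finite \<times> 'a) set"
  assumes sym: "symmetric_constraints F" and ne: "nn_subshift F \<noteq> {}"
    and S: "finite S" "\<And>v. v \<in> S \<Longrightarrow> v $ i \<le> c"
  shows "deficit F (S \<union> reflect i c ` S) \<le> 2 * deficit F S"
proof -
  let ?S' = "S \<union> reflect i c ` S" and ?t = "card {v \<in> S. v $ i = c}"
  let ?A = "real (card (admissible F S))" and ?B = "real (card (admissible F ?S'))"
  let ?l = "ln (real CARD('a))"
  have pos: "?A > 0" "?B > 0"
    using card_admissible_pos[OF ne] S(1) by auto
  have "real (card (admissible F S) ^ 2) \<le> real (CARD('a) ^ ?t * card (admissible F ?S'))"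
    using card_admissible_double[OF sym S] of_nat_le_iff by blast
  then have "?A ^ 2 \<le> real CARD('a) ^ ?t * ?B"
    by simp
  then have "ln (?A ^ 2) \<le> ln (real CARD('a) ^ ?t * ?B)"
    using pos by (subst ln_le_cancel_iff) auto
  also have "\<dots> = real ?t * ?l + ln ?B"
    using pos by (subst ln_mult) (auto simp: ln_realpow)
  finally have le: "2 * ln ?A \<le> real ?t * ?l + ln ?B"
    using pos by (simp add: ln_realpow)
  have "real (card ?S') + real ?t = 2 * real (card S)"
    using card_reflection_double[OF S] by linarith
  then have "real (card ?S') = 2 * real (card S) - real ?t"
    by linarith
  then have eq: "deficit F ?S' = 2 * (real (card S) * ?l) - real ?t * ?l - ln ?B"
    by (simp only: deficit_def left_diff_distrib mult.assoc)
  have arith: "D \<le> 2 * (x - a)" if "2 * a \<le> t + b" "D = 2 * x - t - b"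
    for a b t x D :: real
    using that by argo
  show ?thesis
    unfolding deficit_def[of F S] by (rule arith[OF le eq])
qed

lemma vec_eq_image_PiE: "{v :: 'b ^ 'd::finite. \<forall>i. v $ i \<in> A i} = vec_lambda ` (\<Pi>\<^sub>E i\<in>UNIV. A i)"
proof safe
  fix v :: "'b ^ 'd" assume "\<forall>i. v $ i \<in> A i"
  then show "v \<in> vec_lambda ` (\<Pi>\<^sub>E i\<in>UNIV. A i)"
    by (intro image_eqI[of _ _ "vec_nth v"]) auto
qed auto

lemma finite_vec_box: "(\<And>i. finite (A i)) \<Longrightarrow> finite {v :: 'b ^ 'd::finite. \<forall>i. v $ i \<in> A i}"
  by (simp add: vec_eq_image_PiE finite_PiE)

lemma finite_cube [simp]: "finite (cube n)"
  unfolding cube_def by (rule finite_vec_box) simp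

lemma card_cube: "card (cube n :: (int ^ 'd::finite) set) = n ^ CARD('d)"
proof -
  have "inj (vec_lambda :: ('d \<Rightarrow> int) \<Rightarrow> int ^ 'd)"
    by (simp add: inj_on_def vec_lambda_inject)
  then show ?thesis
    unfolding cube_def vec_eq_image_PiE
    by (subst card_image) (auto intro: inj_on_subset simp: card_PiE)
qed

lemma deficit_cube_double:
  fixes F :: "'d::finite \<Rightarrow> ('a::finite \<times> 'a) set"
  assumes sym: "symmetric_constraints F" and ne: "nn_subshift F \<noteq> {}"
  shows "deficit F (cube (2 * m + 1)) \<le> 2 ^ CARD('d) * deficit F (cube (m + 1))"
proof -
  \<comment> \<open>\<open>I\<close> collects the directions already doubled. Each induction step
    reflects in the far face \<open>m + 1\<close> of one new direction and costs a factor 2.\<close>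
  define box where "box I =
    {v :: int ^ 'd. \<forall>i. v $ i \<in> {1..(if i \<in> I then 2 * int m + 1 else int m + 1)}}" for I
  have "deficit F (box I) \<le> 2 ^ card I * deficit F (box {})" if "finite I" for I
    using that
  proof induction
    case (insert i I)
    let ?c = "int m + 1"
    have "box (insert i I) = box I \<union> reflect i ?c ` box I" (is "_ = ?U")
    proof (intro set_eqI iffI)
      fix v assume v: "v \<in> box (insert i I)"
      show "v \<in> ?U"
      proof (cases "v $ i \<le> ?c")
        case True
        have "v $ j \<in> {1..(if j \<in> I then 2 * int m + 1 else int m + 1)}" for j
          using v True insert.hyps by (cases "j = i") (auto simp: box_def dest: spec[of _ j])
        then show ?thesis
          by (simp add: box_def)
      next
        case False
        have "reflect i ?c v $ j \<in> {1..(if j \<in> I then 2 * int m + 1 else int m + 1)}" for j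
          using v False insert.hyps
          by (cases "j = i") (auto simp: box_def reflect_nth dest: spec[of _ j])
        then show ?thesis
          by (simp add: box_def reflect_image_iff)
      qed
    next
      fix v assume "v \<in> ?U"
      then consider "v \<in> box I" | "reflect i ?c v \<in> box I"
        by (auto simp: reflect_image_iff)
      then have "v $ j \<in> {1..(if j \<in> insert i I then 2 * int m + 1 else int m + 1)}" for j
      proof cases
        case 1
        then have "v $ j \<in> {1..(if j \<in> I then 2 * int m + 1 else int m + 1)}"
          by (simp add: box_def)
        then show ?thesis
          by (auto split: if_splits)
      next
        case 2
        then have "reflect i ?c v $ j \<in> {1..(if j \<in> I then 2 * int m + 1 else int m + 1)}"
          by (simp add: box_def)
        then show ?thesis
          using insert.hyps by (auto simp: reflect_nth split: if_splits)
      qed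
      then show "v \<in> box (insert i I)"
        by (simp add: box_def)
    qed
    moreover have "deficit F ?U \<le> 2 * deficit F (box I)"
    proof (rule deficit_double[OF sym ne])
      show "finite (box I)"
        unfolding box_def by (rule finite_vec_box) simp
      show "v $ i \<le> ?c" if "v \<in> box I" for v
        using that insert.hyps by (auto simp: box_def dest: spec[of _ i])
    qed
    ultimately have "deficit F (box (insert i I)) \<le> 2 * (2 ^ card I * deficit F (box {}))"
      using insert.IH by (metis mult_left_mono order_trans zero_le_numeral)
    then show ?case
      using insert.hyps by simp
  qed simp
  from this[OF finite, of UNIV] have "deficit F (box UNIV) \<le> 2 ^ CARD('d) * deficit F (box {})" .
  also have "box UNIV = cube (2 * m + 1)"
    by (simp add: box_def cube_def add.commute)
  also have "box {} = cube (m + 1)"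
    by (simp add: box_def cube_def add.commute)
  finally show ?thesis .
qed

lemma deficit_cube_pow2:
  fixes F :: "'d::finite \<Rightarrow> ('a::finite \<times> 'a) set"
  assumes "symmetric_constraints F" "nn_subshift F \<noteq> {}"
  shows "deficit F (cube (2 ^ j * m + 1)) \<le> (2 ^ j) ^ CARD('d) * deficit F (cube (m + 1))"
proof (induction j)
  case (Suc j)
  have "deficit F (cube (2 ^ Suc j * m + 1)) \<le> 2 ^ CARD('d) * deficit F (cube (2 ^ j * m + 1))"
    using deficit_cube_double[OF assms, of "2 ^ j * m"] by (simp add: mult.assoc)
  also have "\<dots> \<le> 2 ^ CARD('d) * ((2 ^ j) ^ CARD('d) * deficit F (cube (m + 1)))"
    using Suc by simp
  finally show ?case
    by (simp only: power_Suc power_mult_distrib mult.assoc)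
qed simp

section \<open>Extension by folding\<close>

text \<open>A triangle wave of period \<open>2 * m\<close> with values in \<open>{1..m + 1}\<close>,
  obtained by reflecting again and again in both end points. The shifts by 1 are there because cubes
  start at coordinate 1.\<close>

definition fold_int :: "int \<Rightarrow> int \<Rightarrow> int" where
  "fold_int m k = 1 + (if (k - 1) mod (2 * m) \<le> m then (k - 1) mod (2 * m)
                       else 2 * m - (k - 1) mod (2 * m))"

lemma fold_int_bounds:
  assumes "m \<ge> 1"
  shows "fold_int m k \<in> {1..m + 1}"
proof -
  have "0 \<le> (k - 1) mod (2 * m)" "(k - 1) mod (2 * m) < 2 * m"
    using assms by auto
  then show ?thesis
    by (simp add: fold_int_def)
qed

lemma fold_int_id: "m \<ge> 1 \<Longrightarrow> k \<in> {1..m + 1} \<Longrightarrow> fold_int m k = k"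
  by (simp add: fold_int_def mod_pos_pos_trivial)

text \<open>The end points 1 and \<open>m + 1\<close> are mirrors on lattice points, each attained
  once per period, so the wave never pauses when it turns.\<close>

lemma fold_int_step:
  assumes "m \<ge> 1"
  shows "fold_int m (k + 1) = fold_int m k + 1 \<or> fold_int m k = fold_int m (k + 1) + 1"
proof -
  let ?t = "(k - 1) mod (2 * m)"
  have t: "0 \<le> ?t" "?t < 2 * m"
    using assms by auto
  have "(k + 1 - 1) mod (2 * m) = (?t + 1) mod (2 * m)"
    by (metis add_diff_eq diff_add_eq mod_add_left_eq)
  also have "\<dots> = (if ?t + 1 = 2 * m then 0 else ?t + 1)"
    using t by (auto simp: mod_pos_pos_trivial)
  finally show ?thesis
    using t assms by (auto simp: fold_int_def)
qed

text \<open>Composing a pattern with the coordinatewise folding extends it to the whole lattice: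
  neighbours go to neighbours in the same direction, possibly swapped, which symmetry allows. Side
  at least 2 matters, since a single site obeys no constraint and its symbol need not occur in any
  configuration.\<close>

lemma globally_admissible_eq:
  fixes F :: "'d::finite \<Rightarrow> ('a \<times> 'a) set"
  assumes sym: "symmetric_constraints F" and m: "m \<ge> 1"
  shows "globally_admissible (nn_subshift F) (m + 1) = admissible F (cube (m + 1))"
proof
  show "globally_admissible (nn_subshift F) (m + 1) \<subseteq> admissible F (cube (m + 1))"
    by (auto simp: globally_admissible_def restrict_in_admissible)
  show "admissible F (cube (m + 1)) \<subseteq> globally_admissible (nn_subshift F) (m + 1)"
  proof
    fix P assume P: "P \<in> admissible F (cube (m + 1))"
    define f where "f v = (\<chi> j. fold_int (int m) (v $ j))" for v :: "int ^ 'd"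
    have f_cube: "f v \<in> cube (m + 1)" for v
      using fold_int_bounds[of "int m"] m by (simp add: f_def cube_def add.commute)
    have ok: "(P v, P (v + axis i 1)) \<notin> F i" if "v \<in> cube (m + 1)" "v + axis i 1 \<in> cube (m + 1)" for v i
      using P that by (simp add: admissible_def)
    have "(P (f v), P (f (v + axis i 1))) \<notin> F i" for v i
    proof -
      consider "f (v + axis i 1) = f v + axis i 1" | "f v = f (v + axis i 1) + axis i 1"
        using fold_int_step[of "int m" "v $ i"] m
        by (auto simp: f_def vec_eq_iff axis_def)
      then show ?thesis
      proof cases
        case 1
        then show ?thesis
          using ok[of "f v" i] f_cube by metis
      next
        case 2
        then show ?thesis
          using ok[of "f (v + axis i 1)" i] f_cube sym
          unfolding symmetric_constraints_def by metis
      qed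
    qed
    then have "P \<circ> f \<in> nn_subshift F"
      by (simp add: nn_subshift_def)
    moreover have "restrict (P \<circ> f) (cube (m + 1)) = P"
    proof (rule PiE_ext)
      show "P \<in> cube (m + 1) \<rightarrow>\<^sub>E UNIV"
        using P by (simp add: admissible_def)
      show "restrict (P \<circ> f) (cube (m + 1)) v = P v" if "v \<in> cube (m + 1)" for v
      proof -
        have "f v = v"
          using that m fold_int_id[of "int m"]
          by (simp add: f_def cube_def vec_eq_iff add.commute)
        with that show ?thesis by simp
      qed
    qed auto
    ultimately show "P \<in> globally_admissible (nn_subshift F) (m + 1)"
      unfolding globally_admissible_def by (metis image_eqI)
  qed
qed

section \<open>Existence of the entropy\<close>

text \<open>Cover the large cube by \<open>k ^ CARD('d)\<close> translates of the small one. By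
  shift invariance each translate carries a globally admissible pattern, and these patterns together
  determine the large one.\<close>

lemma card_globally_admissible_le:
  fixes F :: "'d::finite \<Rightarrow> ('a::finite \<times> 'a) set"
  assumes n: "n \<ge> 1" and m: "m \<le> k * n"
  shows "card (globally_admissible (nn_subshift F) m)
           \<le> card (globally_admissible (nn_subshift F) n) ^ (k ^ CARD('d))"
proof -
  let ?G = "globally_admissible (nn_subshift F)"
  \<comment> \<open>Division with remainder in each coordinate, offset by 1 because cubes start at
    1. Cells may overhang \<open>cube m\<close>; the configuration fills them anyway, and
    \<open>glue\<close> discards the excess.\<close>
  define cell where "cell v = (\<chi> j. (v $ j - 1) div int n + 1)" for v :: "int ^ 'd"
  define pos where "pos v = (\<chi> j. (v $ j - 1) mod int n + 1)" for v :: "int ^ 'd"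
  define corner where "corner u = (\<chi> j. int n * (u $ j - 1))" for u :: "int ^ 'd"
  define glue where "glue g = restrict (\<lambda>v. g (cell v) (pos v)) (cube m)"
    for g :: "int ^ 'd \<Rightarrow> int ^ 'd \<Rightarrow> 'a"
  have split: "pos v + corner (cell v) = v" for v
    by (simp add: vec_eq_iff pos_def corner_def cell_def)
  have pos_cube: "pos v \<in> cube n" for v
  proof -
    have "0 \<le> (v $ j - 1) mod int n \<and> (v $ j - 1) mod int n < int n" for j
      using n by simp
    then show ?thesis
      by (simp add: pos_def cube_def) (smt (verit))
  qed
  have cell_cube: "cell v \<in> cube k" if "v \<in> cube m" for v
  proof -
    have "0 \<le> (v $ j - 1) div int n \<and> (v $ j - 1) div int n < int k" for j
    proof -
      have j: "1 \<le> v $ j" "v $ j \<le> int m"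
        using that by (auto simp: cube_def)
      moreover have "int m \<le> int k * int n"
        using m by (metis of_nat_le_iff of_nat_mult)
      ultimately have "v $ j - 1 < int k * int n"
        by linarith
      then show ?thesis
        using n j
        by (smt (verit, best) div_mult_mod_eq mult_right_mono of_nat_0_le_iff of_nat_0_less_iff
            pos_imp_zdiv_nonneg_iff pos_mod_sign less_le_trans zero_less_one)
    qed
    then show ?thesis
      by (simp add: cell_def cube_def) (smt (verit))
  qed
  have fin: "finite (?G n)"
    by (rule finite_subset[of _ "cube n \<rightarrow>\<^sub>E UNIV"]) (auto simp: globally_admissible_def finite_PiE)
  have "?G m \<subseteq> glue ` (cube k \<rightarrow>\<^sub>E ?G n)"
  proof
    fix P assume "P \<in> ?G m"
    then obtain x where x: "x \<in> nn_subshift F" "P = restrict x (cube m)"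
      by (auto simp: globally_admissible_def)
    define g where "g = restrict (\<lambda>u. restrict (\<lambda>w. x (w + corner u)) (cube n)) (cube k)"
    have shift: "(\<lambda>w. x (w + t)) \<in> nn_subshift F" for t
    proof -
      have "(x (v + t), x (v + t + axis i 1)) \<notin> F i" for v i
        using x(1) by (simp add: nn_subshift_def)
      then show ?thesis
        by (simp add: nn_subshift_def add_ac)
    qed
    have "g \<in> cube k \<rightarrow>\<^sub>E ?G n"
      using shift by (auto simp: g_def globally_admissible_def)
    moreover have "P = glue g"
      using x(2) cell_cube pos_cube split by (auto simp: glue_def g_def fun_eq_iff restrict_def)
    ultimately show "P \<in> glue ` (cube k \<rightarrow>\<^sub>E ?G n)"
      by blast
  qed
  moreover have "finite ((cube k :: (int ^ 'd) set) \<rightarrow>\<^sub>E ?G n)"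
    by (simp add: finite_PiE fin)
  ultimately have "card (?G m) \<le> card ((cube k :: (int ^ 'd) set) \<rightarrow>\<^sub>E ?G n)"
    using surj_card_le by blast
  then show ?thesis
    by (simp add: card_PiE card_cube)
qed

definition entropy_at :: "('a, 'd::finite) config set \<Rightarrow> nat \<Rightarrow> real" where
  "entropy_at X n = 1 / real n ^ CARD('d) * ln (real (card (globally_admissible X n)))"

text \<open>The last step of Fekete's argument: the infimum is a lower bound, and \<open>ev\<close>
  bounds the limit superior by every \<open>a n\<close>. Index 0 is left out of the infimum, as
  \<open>entropy_at X 0\<close> is 0 by the convention for division by zero.\<close>

lemma tendsto_INF_of_eventually_le:
  fixes a :: "nat \<Rightarrow> real"
  assumes nonneg: "\<And>n. n \<ge> 1 \<Longrightarrow> a n \<ge> 0"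
    and ev: "\<And>n e. n \<ge> 1 \<Longrightarrow> e > 0 \<Longrightarrow> eventually (\<lambda>m. a m < a n + e) sequentially"
  shows "a \<longlonglongrightarrow> (INF n\<in>{1..}. a n)"
proof (rule order_tendstoI)
  have bdd: "bdd_below (a ` {1..})"
    using nonneg by (auto intro!: bdd_belowI2[of _ 0])
  fix b
  show "\<forall>\<^sub>F m in sequentially. b < a m" if "b < (INF n\<in>{1..}. a n)"
    using eventually_ge_at_top[of 1]
  proof eventually_elim
    case (elim m)
    then have "(INF n\<in>{1..}. a n) \<le> a m"
      by (intro cINF_lower bdd) auto
    with that show ?case by simp
  qed
  show "\<forall>\<^sub>F m in sequentially. a m < b" if "(INF n\<in>{1..}. a n) < b"
  proof -
    have "\<exists>n\<in>{1..}. a n < b"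
      using that by (subst (asm) cINF_less_iff) (use bdd in auto)
    then obtain n where n: "n \<ge> 1" "a n < b"
      by auto
    then show ?thesis
      using ev[of n "b - a n"] by simp
  qed
qed

lemma card_globally_admissible_pos:
  fixes F :: "'d::finite \<Rightarrow> ('a::finite \<times> 'a) set"
  assumes "nn_subshift F \<noteq> {}"
  shows "card (globally_admissible (nn_subshift F) n) > 0"
proof -
  have "finite (globally_admissible (nn_subshift F) n)"
    by (rule finite_subset[of _ "cube n \<rightarrow>\<^sub>E UNIV"]) (auto simp: globally_admissible_def finite_PiE)
  then show ?thesis
    using assms by (simp add: card_gt_0_iff globally_admissible_def)
qed

lemma entropy_at_nonneg:
  fixes F :: "'d::finite \<Rightarrow> ('a::finite \<times> 'a) set"
  assumes "nn_subshift F \<noteq> {}"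
  shows "entropy_at (nn_subshift F) n \<ge> 0"
  using card_globally_admissible_pos[OF assms, of n] by (simp add: entropy_at_def)

text \<open>With \<open>k = m div n + 1\<close> cells per side, the ratio \<open>k / m\<close> is at
  most \<open>1 / n + 1 / m\<close>, so the covering bound divided by \<open>m ^ CARD('d)\<close>
  tends to \<open>entropy_at\<close> at \<open>n\<close>.\<close>

lemma entropy_at_eventually_le:
  fixes F :: "'d::finite \<Rightarrow> ('a::finite \<times> 'a) set"
  assumes ne: "nn_subshift F \<noteq> {}" and n: "n \<ge> 1" and e: "e > 0"
  shows "eventually (\<lambda>m. entropy_at (nn_subshift F) m < entropy_at (nn_subshift F) n + e) sequentially"
proof -
  let ?G = "\<lambda>m. real (card (globally_admissible (nn_subshift F) m))"
  let ?d = "CARD('d)"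
  have lnG: "ln (?G n) \<ge> 0"
    using card_globally_admissible_pos[OF ne, of n] by simp
  have bound: "entropy_at (nn_subshift F) m \<le> (1 / real n + 1 / real m) ^ ?d * ln (?G n)"
    if m: "m \<ge> 1" for m
  proof -
    define k where "k = m div n + 1"
    have "m \<le> k * n"
      using n dividend_less_div_times[of n m] by (simp add: k_def algebra_simps)
    then have "card (globally_admissible (nn_subshift F) m)
        \<le> card (globally_admissible (nn_subshift F) n) ^ (k ^ ?d)"
      by (rule card_globally_admissible_le[OF n])
    then have "?G m \<le> ?G n ^ (k ^ ?d)"
      by (metis of_nat_le_iff of_nat_power)
    then have "ln (?G m) \<le> ln (?G n ^ (k ^ ?d))"
      using card_globally_admissible_pos[OF ne] by (subst ln_le_cancel_iff) auto
    also have "\<dots> = real k ^ ?d * ln (?G n)"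
      using card_globally_admissible_pos[OF ne, of n] by (simp add: ln_realpow)
    finally have "entropy_at (nn_subshift F) m \<le> 1 / real m ^ ?d * (real k ^ ?d * ln (?G n))"
      unfolding entropy_at_def by (intro mult_left_mono) auto
    also have "\<dots> = (real k / real m) ^ ?d * ln (?G n)"
      by (simp add: power_divide)
    also have "\<dots> \<le> (1 / real n + 1 / real m) ^ ?d * ln (?G n)"
    proof (intro mult_right_mono power_mono lnG)
      have "real k \<le> real m / real n + 1"
        using of_nat_div_le_of_nat[of m n, where ?'a = real] by (simp add: k_def)
      then have "real k / real m \<le> (real m / real n + 1) / real m"
        by (intro divide_right_mono) auto
      then show "real k / real m \<le> 1 / real n + 1 / real m"
        using m by (simp add: add_divide_distrib)
    qed auto
    finally show ?thesis .
  qed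
  have "(\<lambda>m. (1 / real n + 1 / real m) ^ ?d * ln (?G n)) \<longlonglongrightarrow> (1 / real n + 0) ^ ?d * ln (?G n)"
    by (intro tendsto_intros lim_1_over_n)
  also have "(1 / real n + 0) ^ ?d * ln (?G n) = entropy_at (nn_subshift F) n"
    by (simp add: entropy_at_def power_divide)
  finally have "eventually (\<lambda>m. (1 / real n + 1 / real m) ^ ?d * ln (?G n)
      < entropy_at (nn_subshift F) n + e) sequentially"
    by (rule order_tendstoD) (use e in simp)
  then show ?thesis
    using eventually_ge_at_top[of 1]
    by eventually_elim (use bound in fastforce)
qed

text \<open>Convergence is what gives \<open>lim\<close> in the definition of the entropy its
  meaning; the description as an infimum yields the upper bound at every fixed
  \<open>n\<close>.\<close>

lemma entropy_at_tendsto: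
  fixes F :: "'d::finite \<Rightarrow> ('a::finite \<times> 'a) set"
  assumes "nn_subshift F \<noteq> {}"
  shows "entropy_at (nn_subshift F) \<longlonglongrightarrow> topological_entropy (nn_subshift F)"
    and "topological_entropy (nn_subshift F) = (INF n\<in>{1..}. entropy_at (nn_subshift F) n)"
proof -
  have lim: "entropy_at (nn_subshift F) \<longlonglongrightarrow> (INF n\<in>{1..}. entropy_at (nn_subshift F) n)"
    using entropy_at_nonneg[OF assms] entropy_at_eventually_le[OF assms]
    by (rule tendsto_INF_of_eventually_le)
  show eq: "topological_entropy (nn_subshift F) = (INF n\<in>{1..}. entropy_at (nn_subshift F) n)"
    using limI[OF lim] by (simp add: topological_entropy_def entropy_at_def[abs_def])
  show "entropy_at (nn_subshift F) \<longlonglongrightarrow> topological_entropy (nn_subshift F)"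
    using lim by (simp add: eq)
qed

section \<open>The upper and lower bounds for the entropy\<close>

lemma topological_entropy_le:
  fixes F :: "'d::finite \<Rightarrow> ('a::finite \<times> 'a) set"
  assumes ne: "nn_subshift F \<noteq> {}" and n: "n \<ge> 1"
  shows "topological_entropy (nn_subshift F)
           \<le> 1 / real n ^ CARD('d) * ln (real (card (locally_admissible F n)))"
proof -
  have "topological_entropy (nn_subshift F) \<le> entropy_at (nn_subshift F) n"
    unfolding entropy_at_tendsto(2)[OF ne]
    by (rule cINF_lower) (use n entropy_at_nonneg[OF ne] in \<open>auto intro!: bdd_belowI2[of _ 0]\<close>)
  also have "\<dots> \<le> 1 / real n ^ CARD('d) * ln (real (card (locally_admissible F n)))"
  proof -
    have "globally_admissible (nn_subshift F) n \<subseteq> locally_admissible F n"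
      by (auto simp: globally_admissible_def locally_admissible_eq restrict_in_admissible)
    then have "card (globally_admissible (nn_subshift F) n) \<le> card (locally_admissible F n)"
      by (intro card_mono) (simp_all add: locally_admissible_eq finite_admissible)
    then show ?thesis
      unfolding entropy_at_def
      using card_globally_admissible_pos[OF ne, of n] by (intro mult_left_mono) auto
  qed
  finally show ?thesis .
qed

text \<open>Follow the entropy along the sides \<open>2 ^ j * n + 1\<close>. There local and global
  admissibility coincide, so the deficit gives \<open>entropy_at\<close> exactly, and the doubling
  estimate bounds it uniformly in \<open>j\<close>.\<close>

lemma topological_entropy_ge:
  fixes F :: "'d::finite \<Rightarrow> ('a::finite \<times> 'a) set"
  assumes sym: "symmetric_constraints F" and ne: "nn_subshift F \<noteq> {}" and n: "n \<ge> 1"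
  shows "topological_entropy (nn_subshift F)
           \<ge> ln (real CARD('a)) - deficit F (cube (n + 1)) / real n ^ CARD('d)"
proof (rule LIMSEQ_le_const)
  let ?d = "CARD('d)" and ?D = "deficit F (cube (n + 1))"
  have "strict_mono (\<lambda>j. 2 ^ j * n + 1)"
    using n by (simp add: strict_mono_Suc_iff)
  then show "(\<lambda>j. entropy_at (nn_subshift F) (2 ^ j * n + 1)) \<longlonglongrightarrow> topological_entropy (nn_subshift F)"
    using LIMSEQ_subseq_LIMSEQ[OF entropy_at_tendsto(1)[OF ne]] by (simp add: comp_def)
  have "ln (real CARD('a)) - ?D / real n ^ ?d \<le> entropy_at (nn_subshift F) (2 ^ j * n + 1)" for j
  proof -
    define m where "m = 2 ^ j * n"
    have m: "m \<ge> 1"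
      using n by (simp add: m_def)
    have D: "?D \<ge> 0"
      by (rule deficit_nonneg[OF ne]) simp
    have "entropy_at (nn_subshift F) (m + 1)
        = ln (real CARD('a)) - deficit F (cube (m + 1)) / real (m + 1) ^ ?d"
      unfolding entropy_at_def globally_admissible_eq[OF sym m]
      by (simp add: deficit_def card_cube diff_divide_distrib del: of_nat_add)
    \<comment> \<open>Shrinking the denominator from \<open>m + 1\<close> to
      \<open>m = 2 ^ j * n\<close> lets the powers of 2 cancel exactly; this uses
      \<open>?D \<ge> 0\<close>.\<close>
    moreover have "deficit F (cube (m + 1)) / real (m + 1) ^ ?d \<le> ((2 ^ j) ^ ?d * ?D) / real m ^ ?d"
      using deficit_cube_pow2[OF sym ne, of j n] D m
      by (intro frac_le power_mono) (auto simp: m_def)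
    moreover have "((2 ^ j) ^ ?d * ?D) / real m ^ ?d = ?D / real n ^ ?d"
      by (simp add: m_def power_mult_distrib)
    ultimately show ?thesis
      by (simp add: m_def)
  qed
  then show "\<exists>N. \<forall>j\<ge>N. ln (real CARD('a)) - ?D / real n ^ ?d
      \<le> entropy_at (nn_subshift F) (2 ^ j * n + 1)"
    by blast
qed

text \<open>\<open>q d n\<close> is the binomial expansion of the left side with its
  \<open>k\<close>-th term multiplied by \<open>(2 ^ d - 1) / (2 ^ d - 2 ^ k)\<close>, which is at
  least 1.\<close>

lemma q_ge: "(real n + 1) ^ d - real n ^ d \<le> q d n"
proof -
  have "(real n + 1) ^ d = (\<Sum>k\<le>d. real (d choose k) * real n ^ k)"
    by (simp add: binomial_ring)
  also have "\<dots> = (\<Sum>k<d. real (d choose k) * real n ^ k) + real n ^ d"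
    by (simp add: lessThan_Suc_atMost[symmetric])
  also have "(\<Sum>k<d. real (d choose k) * real n ^ k)
      \<le> (\<Sum>k<d. (2 ^ d - 1) * (real (d choose k) / (2 ^ d - 2 ^ k) * real n ^ k))"
  proof (rule sum_mono)
    fix k assume "k \<in> {..<d}"
    then have pos: "(2::real) ^ d - 2 ^ k > 0"
      by simp
    then have "1 \<le> (2 ^ d - 1) / ((2::real) ^ d - 2 ^ k)"
      by (simp add: le_divide_eq)
    then have "1 * (real (d choose k) * real n ^ k)
        \<le> (2 ^ d - 1) / (2 ^ d - 2 ^ k) * (real (d choose k) * real n ^ k)"
      by (intro mult_right_mono) auto
    then show "real (d choose k) * real n ^ k
        \<le> (2 ^ d - 1) * (real (d choose k) / (2 ^ d - 2 ^ k) * real n ^ k)"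
      by (simp add: field_simps)
  qed
  finally show ?thesis
    by (simp add: q_def sum_distrib_left)
qed

theorem theorem1:
  fixes F :: "'d::finite \<Rightarrow> ('a::finite \<times> 'a) set"
    and n :: nat
  assumes "symmetric_constraints F"
    and "nn_subshift F \<noteq> {}"
    and "n \<ge> 1"
  shows "1 / real n ^ CARD('d) *
           (ln (real (card (locally_admissible F (n + 1)))) - q CARD('d) n * ln (real CARD('a)))
         \<le> topological_entropy (nn_subshift F)
       \<and> topological_entropy (nn_subshift F)
         \<le> 1 / real n ^ CARD('d) * ln (real (card (locally_admissible F n)))"
proof
  let ?d = "CARD('d)" and ?l = "ln (real CARD('a))"
  let ?L = "ln (real (card (locally_admissible F (n + 1))))"
  have "((real n + 1) ^ ?d - real n ^ ?d) * ?l \<le> q ?d n * ?l"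
    by (intro mult_right_mono q_ge) simp
  \<comment> \<open>The deficit is \<open>(n + 1) ^ ?d * ?l - ?L\<close>, so the right side is
    \<open>?L\<close> minus \<open>?l\<close> for each of the \<open>(n + 1) ^ ?d - n ^ ?d\<close>
    extra sites of the larger cube.\<close>
  then have "?L - q ?d n * ?l \<le> real n ^ ?d * ?l - deficit F (cube (n + 1))"
    by (simp add: deficit_def locally_admissible_eq card_cube algebra_simps)
  then have "1 / real n ^ ?d * (?L - q ?d n * ?l)
      \<le> 1 / real n ^ ?d * (real n ^ ?d * ?l - deficit F (cube (n + 1)))"
    by (intro mult_left_mono) auto
  also have "\<dots> = ?l - deficit F (cube (n + 1)) / real n ^ ?d"
    using assms(3) by (simp add: field_simps)
  also have "\<dots> \<le> topological_entropy (nn_subshift F)"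
    by (rule topological_entropy_ge[OF assms])
  finally show "1 / real n ^ ?d * (?L - q ?d n * ?l) \<le> topological_entropy (nn_subshift F)" .
  show "topological_entropy (nn_subshift F)
      \<le> 1 / real n ^ ?d * ln (real (card (locally_admissible F n)))"
    by (rule topological_entropy_le[OF assms(2,3)])
qed

end
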